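(* Let $I\subset\mathbb{R}$ be a proper (nondegenerate) subinterval, and let $f:I\to\mathbb{R}$ be locally integrable. Then for every $t>0$, $$\omega(Mf,t)\le\int_0^1\omega(|f|,tu)\,du .$$ This inequality is sharp in the sense that for every modulus of continuity $\omega$ and every real $\delta>0$ with $\delta\le|I|$, there exists a nonnegative, uniformly continuous function $\psi:I\to\mathbb{R}$ such that for all $t\in(0,\delta)$ we have $\omega(\psi,t)=\omega(t)$ and $$\omega(M\psi,t)=\int_0^1\omega(tu)\,du .$$ Moreover, if $\omega$ is bounded, then $\psi$ can be chosen so that both equalities $\omega(\psi,t)=\omega(t)$ and $\omega(M\psi,t)=\int_0^1\omega(tu)\,du$ hold for all $t>0$ with $t<|I|$.
   Context: A proper subinterval $I$ of $\mathbb{R}$ is a nondegenerate interval (neither empty nor a single point; bounded or unbounded; open, closed or half-open) with $I\ne\mathbb{R}$; $|I|\in(0,\infty]$ is its length. For locally integrable $f:I\to\mathbb{R}$, the uncentered (local) maximal function is $Mf(x)=\sup\frac1{|J|}\int_J|f(y)|\,dy\in[0,\infty]$ for $x\in I$, the supremum being over all bounded nondegenerate intervals $J$ with $x\in J\subset I$. The modulus of continuity of a function $g$ on $I$ is $\omega(g,\delta)=\sup\{|g(x)-g(y)|:x,y\in I,\ |x-y|\le\delta\}\in[0,\infty]$; if $g=Mf$ takes infinite values, $|g(x)-g(y)|$ is interpreted as $0$ when both values are $\infty$. A modulus of continuity is a function $\omega:[0,\infty)\to[0,\infty)$ that is continuous, nondecreasing, subadditive, with $\omega(0)=0$, and not identically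 zero. *)

theory Defs
  imports "HOL-Analysis.Analysis"
begin

definition nondegenerate_interval :: "real set \<Rightarrow> bool" where
  "nondegenerate_interval I \<longleftrightarrow> is_interval I \<and> (\<exists>a\<in>I. \<exists>b\<in>I. a < b)"

definition proper_subinterval :: "real set \<Rightarrow> bool" where
  "proper_subinterval I \<longleftrightarrow> nondegenerate_interval I \<and> I \<noteq> UNIV"

text \<open>
  A function on \<open>I\<close> is represented by a total function on the reals; every notion below
  depends only on its values on \<open>I\<close>. Local integrability is integrability (with respect to
  Lebesgue measure) on the compact subsets of \<open>I\<close>, so a locally integrable function need not be
  integrable near an endpoint that does not belong to \<open>I\<close>.
\<close>

definition locally_integrable_on :: "real set \<Rightarrow> (real \<Rightarrow> real) \<Rightarrow> bool" where
  "locally_integrable_on I f \<longleftrightarrow> (\<forall>K. compact K \<and> K \<subseteq> I \<longrightarrow> f absolutely_integrable_on K)"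

definition maximal_function :: "real set \<Rightarrow> (real \<Rightarrow> real) \<Rightarrow> real \<Rightarrow> ennreal" where
  "maximal_function I f x =
     (SUP J \<in> {J. nondegenerate_interval J \<and> bounded J \<and> x \<in> J \<and> J \<subseteq> I}.
        (\<integral>\<^sup>+ y \<in> J. ennreal \<bar>f y\<bar> \<partial>lebesgue) / emeasure lborel J)"

text \<open>
  The case distinction makes the distance of two equal infinite values 0; on \<open>ereal\<close>,
  \<open>\<infinity> - \<infinity> = \<infinity>\<close>.
\<close>

definition ext_dist :: "ereal \<Rightarrow> ereal \<Rightarrow> ennreal" where
  "ext_dist a b = (if a = b then 0 else e2ennreal \<bar>a - b\<bar>)"

definition modulus_of :: "real set \<Rightarrow> (real \<Rightarrow> ereal) \<Rightarrow> real \<Rightarrow> ennreal" where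
  "modulus_of I g d =
     (SUP (x, y) \<in> {(x, y). x \<in> I \<and> y \<in> I \<and> \<bar>x - y\<bar> \<le> d}. ext_dist (g x) (g y))"

definition modulus_of_continuity :: "(real \<Rightarrow> real) \<Rightarrow> bool" where
  "modulus_of_continuity w \<longleftrightarrow>
     (\<forall>s\<ge>0. 0 \<le> w s) \<and>
     continuous_on {0..} w \<and>
     mono_on {0..} w \<and>
     (\<forall>s\<ge>0. \<forall>t\<ge>0. w (s + t) \<le> w s + w t) \<and>
     w 0 = 0 \<and>
     (\<exists>s\<ge>0. w s \<noteq> 0)"

end

theory Submission imports Defs
begin

text \<open>
  If \<open>y \<notin> J \<ni> x\<close>, let \<open>e\<close> be the endpoint of \<open>J\<close> away from \<open>y\<close> and stretch \<open>J\<close> affinely, with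
  \<open>e\<close> fixed, onto the interval \<open>J'\<close> reaching from \<open>e\<close> to \<open>y\<close>. The point with relative position \<open>u\<close>
  moves by at most \<open>u * \<bar>x - y\<bar>\<close>, so the average of \<open>\<bar>f\<bar>\<close> over \<open>J\<close> exceeds that over \<open>J'\<close> by at
  most the integral of the modulus of \<open>\<bar>f\<bar>\<close> at \<open>t * u\<close>.

  For sharpness let \<open>e\<close> be a finite endpoint of \<open>I\<close>, let \<open>w \<le> B\<close> and \<open>\<psi> x = B - w \<bar>x - e\<bar>\<close>. The
  best interval at a point \<open>y\<close> is the one from \<open>e\<close> to \<open>y\<close>, and comparison with points tending to
  \<open>e\<close> gives equality. An unbounded \<open>w\<close> is first replaced by \<open>w (min r \<delta>)\<close>.
\<close>

section \<open>Affine parametrization of intervals and averages\<close>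

text \<open>The sign of \<open>c\<close> is arbitrary, so that either endpoint of \<open>J\<close> can serve as the base point \<open>e\<close>.\<close>

definition spans :: "real set \<Rightarrow> real \<Rightarrow> real \<Rightarrow> bool" where
  "spans J e c \<longleftrightarrow> c \<noteq> 0 \<and> (\<lambda>u. e + c * u) ` {0<..<1} \<subseteq> J \<and> J \<subseteq> (\<lambda>u. e + c * u) ` {0..1}"

lemma spans_nonzero: "spans J e c \<Longrightarrow> c \<noteq> 0"
  and spans_interior: "spans J e c \<Longrightarrow> 0 < u \<Longrightarrow> u < 1 \<Longrightarrow> e + c * u \<in> J"
  and spansE: "spans J e c \<Longrightarrow> x \<in> J \<Longrightarrow> (\<And>u. 0 \<le> u \<Longrightarrow> u \<le> 1 \<Longrightarrow> x = e + c * u \<Longrightarrow> P) \<Longrightarrow> P"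
  unfolding spans_def by auto

lemma image_affine_iff:
  fixes e c :: real
  assumes "c \<noteq> 0"
  shows "x \<in> (\<lambda>u. e + c * u) ` A \<longleftrightarrow> (x - e) / c \<in> A"
  using assms by (force simp: field_simps image_iff)

text \<open>The affine substitution scales integral and length by the same factor
  \<open>\<bar>c\<bar>\<close>, and \<open>J\<close> differs from the open span only in the null set
  of its possible endpoints. Measurability is asked on the open span alone, where local
  integrability can supply it.\<close>

lemma average_spans:
  fixes g :: "real \<Rightarrow> ennreal"
  assumes J: "spans J e c"
    and meas: "(\<lambda>x. g x * indicator ((\<lambda>u. e + c * u) ` {0<..<1}) x) \<in> borel_measurable lebesgue"
  shows "(\<integral>\<^sup>+ y \<in> J. g y \<partial>lebesgue) / emeasure lborel J = (\<integral>\<^sup>+ u \<in> {0<..<1}. g (e + c * u) \<partial>lebesgue)"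
proof -
  define S where "S = (\<lambda>u. e + c * u) ` {0<..<1}"
  have c: "c \<noteq> 0" and SJ: "S \<subseteq> J" and JS: "J - S \<subseteq> {e, e + c}"
    using J unfolding spans_def S_def by (auto simp: image_iff less_le)
  have [simp]: "indicator S (e + c * u) = (indicator {0<..<1} u :: ennreal)" for u
    using c by (auto simp: S_def indicator_def)
  have finJS: "finite (J - S)"
    using JS finite_subset by blast
  have S: "S \<in> sets borel"
    unfolding S_def
    by (intro real_interval_borel_measurable, unfold is_interval_connected_1)
      (intro connected_continuous_image continuous_intros, auto)
  have AE: "AE y in lebesgue. h y * indicator J y = h y * indicator S y" for h :: "real \<Rightarrow> ennreal"
  proof (rule AE_I')
    show "J - S \<in> null_sets lebesgue"
      using finJS by (simp add: finite_imp_null_set_lborel null_sets_completionI)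
  qed (use SJ in \<open>auto simp: indicator_def split: if_splits\<close>)
  have subst: "(\<integral>\<^sup>+ y \<in> J. h y \<partial>lebesgue) = ennreal \<bar>c\<bar> * (\<integral>\<^sup>+ u \<in> {0<..<1}. h (e + c * u) \<partial>lebesgue)"
    if "(\<lambda>x. h x * indicator S x) \<in> borel_measurable lebesgue" for h :: "real \<Rightarrow> ennreal"
  proof -
    have "(\<integral>\<^sup>+ y \<in> J. h y \<partial>lebesgue) = (\<integral>\<^sup>+ y \<in> S. h y \<partial>lebesgue)"
      by (rule nn_integral_cong_AE[OF AE])
    also have "\<dots> = ennreal \<bar>c\<bar> * (\<integral>\<^sup>+ u \<in> {0<..<1}. h (e + c * u) \<partial>lebesgue)"
      using nn_integral_real_affine_lebesgue[OF that c, of e] by simp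
    finally show ?thesis .
  qed
  have Jb: "J \<in> sets borel"
  proof -
    have "J = S \<union> (J - S)" using SJ by auto
    also have "\<dots> \<in> sets borel"
      using S finJS by (intro sets.Un) (auto intro: borel_closed finite_imp_closed)
    finally show ?thesis .
  qed
  \<comment> \<open>The same substitution with the constant integrand 1 computes the length of
    \<open>J\<close>.\<close>
  have "emeasure lborel J = (\<integral>\<^sup>+ y \<in> J. 1 \<partial>lebesgue)"
    using Jb by (simp add: nn_integral_completion)
  also have "\<dots> = ennreal \<bar>c\<bar>"
    using S by (subst subst) (auto simp: nn_integral_completion intro!: measurable_completion)
  finally have J1: "emeasure lborel J = ennreal \<bar>c\<bar>" .
  show ?thesis
    using subst[of g] meas c unfolding J1 S_def
    by (metis abs_le_zero_iff ennreal_mult_divide_eq ennreal_neq_top ennreal_eq_0_iff mult.commute)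
qed

text \<open>Here \<open>a\<close> is the infimum and \<open>a + L\<close> the supremum of
  \<open>J\<close>. Both orientations are provided because the base point must later be the endpoint
  away from a given point.\<close>

lemma spans_exists:
  assumes "nondegenerate_interval J" "bounded J"
  obtains a L where "0 < L" "spans J a L" "spans J (a + L) (- L)"
proof -
  from assms obtain p q where J: "is_interval J" "p \<in> J" "q \<in> J" "p < q"
    unfolding nondegenerate_interval_def by auto
  have bdd: "bdd_below J" "bdd_above J"
    using assms(2) bounded_imp_bdd_below bounded_imp_bdd_above by auto
  define a b where "a = Inf J" and "b = Sup J"
  have sub: "J \<subseteq> {a..b}"
    using bdd by (auto simp: a_def b_def cInf_lower cSup_upper)
  have L: "a < b" using subsetD[OF sub J(2)] subsetD[OF sub J(3)] J(4) by simp
  have inner: "z \<in> J" if az: "a < z" and zb: "z < b" for z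
  proof -
    obtain x where "x \<in> J" "x < z"
      using cInf_lessD[of J z] az J(2) unfolding a_def by auto
    moreover obtain y where "y \<in> J" "z < y"
      using less_cSupD[of J z] zb J(2) unfolding b_def by auto
    ultimately show ?thesis using J(1) unfolding is_interval_1 by (meson less_imp_le)
  qed
  have 1: "spans J a (b - a)"
    unfolding spans_def
  proof (intro conjI subsetI)
    fix z assume "z \<in> (\<lambda>u. a + (b - a) * u) ` {0<..<1}"
    then have "(z - a) / (b - a) \<in> {0<..<1}" using L by (subst (asm) image_affine_iff) auto
    then show "z \<in> J" using L by (intro inner) (auto simp: field_simps)
  next
    fix z assume "z \<in> J"
    then have "z \<in> {a..b}" using sub by auto
    then show "z \<in> (\<lambda>u. a + (b - a) * u) ` {0..1}"
      using L by (subst image_affine_iff) (auto simp: field_simps)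
  qed (use L in auto)
  have 2: "spans J b (a - b)"
    unfolding spans_def
  proof (intro conjI subsetI)
    fix z assume "z \<in> (\<lambda>u. b + (a - b) * u) ` {0<..<1}"
    then have "(z - b) / (a - b) \<in> {0<..<1}" using L by (subst (asm) image_affine_iff) auto
    then show "z \<in> J" using L by (intro inner) (auto simp: field_simps)
  next
    fix z assume "z \<in> J"
    then have "z \<in> {a..b}" using sub by auto
    then show "z \<in> (\<lambda>u. b + (a - b) * u) ` {0..1}"
      using L by (subst image_affine_iff) (auto simp: field_simps)
  qed (use L in auto)
  show thesis
    using that[of "b - a" a] 1 2 L by simp
qed

lemma spans_exists_dir:
  assumes "nondegenerate_interval J" "bounded J" "\<bar>s\<bar> = 1"
  obtains e L where "0 < L" "spans J e (s * L)"
proof -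
  obtain a L where "0 < L" "spans J a L" "spans J (a + L) (- L)"
    using spans_exists[OF assms(1,2)] .
  moreover have "s = 1 \<or> s = -1" using assms(3) by linarith
  ultimately show thesis using that by auto
qed

section \<open>Moduli of continuity of extended-valued functions\<close>

text \<open>Sums instead of differences absorb the infinite values: two infinite values are
  compatible with every \<open>c\<close>, while one infinite and one finite value force
  \<open>c\<close> to be infinite.\<close>

lemma ext_dist_le_iff:
  "ext_dist (enn2ereal a) (enn2ereal b) \<le> c \<longleftrightarrow> a \<le> b + c \<and> b \<le> a + c"
proof (cases a rule: ennreal_cases; cases b rule: ennreal_cases)
  fix x y :: real assume "0 \<le> x" "a = ennreal x" "0 \<le> y" "b = ennreal y"
  then show ?thesis
    by (cases c rule: ennreal_cases)
      (auto simp: ext_dist_def enn2ereal_ennreal e2ennreal_ereal ennreal_le_iff2 abs_le_iff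
        simp flip: ennreal_plus)
qed (auto simp: ext_dist_def top_add top_unique)

text \<open>Symmetry of the index set absorbs the absolute value and, with it, the \<open>\<infinity> - \<infinity>\<close> convention.\<close>

lemma modulus_of_le_iff:
  "modulus_of I (\<lambda>x. enn2ereal (g x)) t \<le> c \<longleftrightarrow>
    (\<forall>x\<in>I. \<forall>y\<in>I. \<bar>x - y\<bar> \<le> t \<longrightarrow> g x \<le> g y + c)"
  unfolding modulus_of_def by (auto simp: SUP_le_iff ext_dist_le_iff abs_minus_commute)

lemma le_add_modulus_of:
  assumes "x \<in> I" "y \<in> I" "\<bar>x - y\<bar> \<le> t"
  shows "g x \<le> g y + modulus_of I (\<lambda>x. enn2ereal (g x)) t"
  using assms modulus_of_le_iff[of I g t "modulus_of I (\<lambda>x. enn2ereal (g x)) t"] by auto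

lemma mono_modulus_of: "mono (modulus_of I g)"
  unfolding modulus_of_def by (intro monoI SUP_subset_mono) auto

text \<open>Superlevel sets of a monotone function are intervals. This covers the modulus of an
  arbitrary \<open>f\<close>, which may be discontinuous and infinite.\<close>

lemma borel_measurable_mono_ennreal:
  fixes f :: "real \<Rightarrow> ennreal"
  assumes "mono f"
  shows "f \<in> borel_measurable borel"
proof (rule borel_measurableI_ge)
  fix y
  have "is_interval {x. y \<le> f x}"
    using assms unfolding is_interval_1 mono_def by (auto intro: order_trans)
  then show "{x \<in> space borel. y \<le> f x} \<in> sets borel"
    using real_interval_borel_measurable by simp
qed

section \<open>The upper bound for locally integrable functions\<close>

lemma maximal_function_ge:
  assumes "nondegenerate_interval J" "bounded J" "x \<in> J" "J \<subseteq> I"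
  shows "(\<integral>\<^sup>+ y \<in> J. ennreal \<bar>f y\<bar> \<partial>lebesgue) / emeasure lborel J \<le> maximal_function I f x"
  unfolding maximal_function_def by (rule SUP_upper) (use assms in auto)

text \<open>The endpoints of \<open>J\<close> may lie outside \<open>I\<close>, so \<open>f\<close>
  is controlled only on compact pieces. The compact sets \<open>K n\<close> exhaust the open span,
  and measurability passes to the pointwise limit.\<close>

lemma locally_integrable_measurable_spans:
  assumes f: "locally_integrable_on I f" and J: "spans J e c" "J \<subseteq> I"
  shows "(\<lambda>x. ennreal \<bar>f x\<bar> * indicator ((\<lambda>u. e + c * u) ` {0<..<1}) x) \<in> borel_measurable lebesgue"
proof -
  define K where "K n = (\<lambda>u. e + c * u) ` {1 / (real n + 2)..1 - 1 / (real n + 2)}" for n :: nat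
  have c: "c \<noteq> 0" using J(1) by (rule spans_nonzero)
  have inc: "incseq K"
    unfolding K_def by (intro monoI image_mono) (auto intro: frac_le order_trans)
  have "(\<Union>n. {1 / (real n + 2)..1 - 1 / (real n + 2)}) = {0<..<1}"
  proof safe
    fix n and x :: real assume "x \<in> {1 / (real n + 2)..1 - 1 / (real n + 2)}"
    moreover have "0 < 1 / (real n + 2)" by simp
    ultimately show "x \<in> {0<..<1}" unfolding atLeastAtMost_iff greaterThanLessThan_iff by linarith
  next
    fix x :: real assume "x \<in> {0<..<1}"
    then obtain n where n: "inverse (real (Suc n)) < min x (1 - x)"
      using reals_Archimedean[of "min x (1 - x)"] by auto
    have "1 / (real n + 2) \<le> inverse (real (Suc n))" by (simp add: field_simps)
    then show "x \<in> (\<Union>n. {1 / (real n + 2)..1 - 1 / (real n + 2)})"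
      using n by (intro UN_I[of n]) auto
  qed
  then have UN: "(\<Union>n. K n) = (\<lambda>u. e + c * u) ` {0<..<1}"
    unfolding K_def image_UN[symmetric] by simp
  have "K n \<subseteq> J" for n using UN J unfolding spans_def by blast
  moreover have "compact (K n)" for n
    unfolding K_def by (intro compact_continuous_image continuous_intros) auto
  ultimately have "f absolutely_integrable_on K n" for n
    using f J(2) unfolding locally_integrable_on_def by blast
  then have [measurable]: "(\<lambda>x. indicator (K n) x * f x) \<in> borel_measurable lebesgue" for n
    unfolding set_integrable_def by (auto dest: borel_measurable_integrable)
  have "(\<lambda>x. indicator (\<Union>n. K n) x * f x) \<in> borel_measurable lebesgue"
    by (rule borel_measurable_LIMSEQ_real[where u = "\<lambda>n x. indicator (K n) x * f x"])
      (auto intro!: tendsto_mult LIMSEQ_indicator_incseq inc)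
  then have "(\<lambda>x. ennreal \<bar>indicator (\<Union>n. K n) x * f x\<bar>) \<in> borel_measurable lebesgue"
    by measurable
  also have "(\<lambda>x. ennreal \<bar>indicator (\<Union>n. K n) x * f x\<bar>)
      = (\<lambda>x. ennreal \<bar>f x\<bar> * indicator ((\<lambda>u. e + c * u) ` {0<..<1}) x)"
    unfolding UN by (auto simp: indicator_def)
  finally show ?thesis .
qed

text \<open>Geometric core of the upper bound. Adjoining the segment from \<open>x\<close> to
  \<open>y\<close> moves only the endpoint of \<open>J\<close> facing \<open>y\<close>. The gain in
  length is at most \<open>\<bar>x - y\<bar>\<close> because \<open>x\<close> is no farther from
  \<open>e\<close> than that endpoint.\<close>

lemma spans_extend:
  assumes J: "nondegenerate_interval J" "bounded J" "x \<in> J" "J \<subseteq> I"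
    and I: "is_interval I" "y \<in> I" "y \<notin> J"
  obtains J' e c d where "spans J e c" "spans J' e d" "nondegenerate_interval J'" "bounded J'"
    "y \<in> J'" "J' \<subseteq> I" "\<bar>c - d\<bar> \<le> \<bar>x - y\<bar>"
proof -
  \<comment> \<open>The direction from \<open>x\<close> to \<open>y\<close>; the base point
    \<open>e\<close> chosen below is then the endpoint of \<open>J\<close> away from
    \<open>y\<close>.\<close>
  define s where "s = sgn (y - x)"
  have xy: "x \<noteq> y" using J I by auto
  then have s: "\<bar>s\<bar> = 1" "\<bar>x - y\<bar> = s * (y - x)" by (auto simp: s_def sgn_if)
  have ss: "s * s = 1" using s(1) by (metis abs_mult_self_eq mult_1)
  obtain e L where L: "0 < L" "spans J e (s * L)"
    using spans_exists_dir[OF J(1,2) s(1)] .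
  obtain u where u: "0 \<le> u" "u \<le> 1" "x = e + s * L * u"
    using spansE[OF L(2) J(3)] .
  define D where "D = s * (y - e)"
  have y: "y = e + s * D" using ss by (simp add: D_def mult.assoc[symmetric])
  \<comment> \<open>\<open>D\<close> is the signed distance from \<open>e\<close> to
    \<open>y\<close>. If it were less than \<open>L\<close>, then \<open>y\<close> would have
    parameter \<open>D / L\<close> strictly between 0 and 1 and hence lie in
    \<open>J\<close>.\<close>
  have "L \<le> D"
  proof (rule ccontr)
    assume "\<not> L \<le> D"
    then have D: "D < L" by simp
    have "s * (y - x) = (s * s) * (D - L * u)" unfolding y u(3) by (simp add: algebra_simps)
    then have "L * u < D" using s(2) xy ss by simp
    moreover have "0 \<le> L * u" using u L by simp
    ultimately have "0 < D / L" "D / L < 1" using L(1) D by (auto simp: field_simps intro: order_le_less_trans)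
    from spans_interior[OF L(2) this] have "y \<in> J" using L(1) y by simp
    with I show False by simp
  qed
  \<comment> \<open>A union, so that \<open>J'\<close> inherits from \<open>J\<close> whether it
    contains \<open>e\<close>; this keeps it inside \<open>I\<close> even if \<open>e\<close> is not
    in \<open>I\<close>.\<close>
  define J' where "J' = J \<union> closed_segment x y"
  have J1: "is_interval J" using J(1) by (simp add: nondegenerate_interval_def)
  have "is_interval J'"
    unfolding J'_def using J1 J(3)
    by (intro is_real_interval_union) (auto simp: is_interval_convex_1)
  then have J'1: "nondegenerate_interval J'"
    using J(1) unfolding nondegenerate_interval_def J'_def by blast
  have J'2: "bounded J'" using J(2) by (simp add: J'_def bounded_closed_segment)
  have J'3: "J' \<subseteq> I"
    using J I unfolding J'_def by (auto dest!: closed_segment_subset[of x I y] simp: is_interval_convex_1)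
  \<comment> \<open>In the parametrization of \<open>J'\<close> the point \<open>x\<close> has
    parameter \<open>L * u / D\<close> and \<open>y\<close> has parameter 1.\<close>
  have seg: "closed_segment x y = (\<lambda>v. e + (s * D) * v) ` {L * u / D..1}"
  proof -
    have "D > 0" using L \<open>L \<le> D\<close> by simp
    have "s = 1 \<or> s = -1" using s(1) by linarith
    moreover from this have "(z - e) / (s * D) = s * (z - e) / D" for z
      by (auto simp: minus_divide_left)
    moreover have "closed_segment e' f' = {min e' f'..max e' f'}" for e' f' :: real
      by (auto simp: closed_segment_eq_real_ivl)
    moreover have "L * u \<le> D"
      using mult_left_le[OF u(2) less_imp_le[OF L(1)]] \<open>L \<le> D\<close> by linarith
    ultimately show ?thesis
      using \<open>D > 0\<close> unfolding y u(3)
      by (intro set_eqI, subst image_affine_iff) (auto simp: divide_le_cancel divide_le_eq_1 min_def max_def)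
  qed
  have "spans J' e (s * D)"
    unfolding spans_def
  proof (intro conjI subsetI)
    show "s * D \<noteq> 0" using s L \<open>L \<le> D\<close> by auto
    then have D: "D > 0" using L \<open>L \<le> D\<close> by simp
    show "z \<in> J'" if zim: "z \<in> (\<lambda>v. e + (s * D) * v) ` {0<..<1}" for z
    proof -
      obtain v where v: "0 < v" "v < 1" "z = e + s * D * v" using zim by auto
      show ?thesis
      \<comment> \<open>At distance less than \<open>L\<close> from \<open>e\<close> the point is
        interior to \<open>J\<close>; from distance \<open>L\<close> on it is past \<open>x\<close>,
        hence on the segment.\<close>
      proof (cases "D * v < L")
        case True
        then have "e + s * L * (D * v / L) \<in> J"
          using v D L by (intro spans_interior[OF L(2)]) (auto simp: field_simps)
        then show ?thesis using v L by (simp add: J'_def mult.assoc)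
      next
        case False
        have "L * u \<le> L" using mult_left_le[of u L] u L by simp
        then have "v \<in> {L * u / D..1}" using v D False by (auto simp: field_simps)
        then show ?thesis using v unfolding J'_def seg by auto
      qed
    qed
    show "z \<in> (\<lambda>v. e + (s * D) * v) ` {0..1}" if "z \<in> J'" for z
    proof (cases "z \<in> J")
      case True
      then obtain v where v: "0 \<le> v" "v \<le> 1" "z = e + s * L * v"
        using spansE[OF L(2)] by metis
      have "L * v \<le> D" using mult_left_le[OF v(2) less_imp_le[OF L(1)]] \<open>L \<le> D\<close> by linarith
      then have "L * v / D \<in> {0..1}" using v D L by (auto simp: field_simps)
      moreover have "z = e + (s * D) * (L * v / D)" using v D by simp
      ultimately show ?thesis by blast
    next
      case False
      then have "z \<in> closed_segment x y" using that by (auto simp: J'_def)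
      moreover have "L * u / D \<ge> 0" using u L D by simp
      ultimately show ?thesis unfolding seg by force
    qed
  qed
  moreover have "\<bar>s * L - s * D\<bar> \<le> \<bar>x - y\<bar>"
  proof -
    have "s * (y - x) = (s * s) * (D - L * u)" unfolding y u(3) by (simp add: algebra_simps)
    moreover have "L * u \<le> L" using mult_left_le[of u L] u L by simp
    ultimately have "D - L \<le> \<bar>x - y\<bar>" using s(2) ss by simp
    moreover have "\<bar>s * L - s * D\<bar> = \<bar>s\<bar> * \<bar>L - D\<bar>" by (simp add: abs_mult[symmetric] algebra_simps)
    ultimately show ?thesis using s(1) \<open>L \<le> D\<close> by simp
  qed
  ultimately show thesis
    using that[OF L(2) _ J'1 J'2 _ J'3] by (auto simp: J'_def)
qed

proposition modulus_of_maximal_function_le: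
  assumes I: "is_interval I" and f: "locally_integrable_on I f"
  shows "modulus_of I (\<lambda>x. enn2ereal (maximal_function I f x)) t
    \<le> (\<integral>\<^sup>+ u \<in> {0..1}. modulus_of I (\<lambda>x. ereal \<bar>f x\<bar>) (t * u) \<partial>lborel)" (is "_ \<le> ?W")
proof (cases "0 \<le> t")
  case True
  define om where "om = modulus_of I (\<lambda>x. ereal \<bar>f x\<bar>)"
  have om: "ennreal \<bar>f p\<bar> \<le> ennreal \<bar>f q\<bar> + om r" if "p \<in> I" "q \<in> I" "\<bar>p - q\<bar> \<le> r" for p q r
    using le_add_modulus_of[OF that, of "\<lambda>x. ennreal \<bar>f x\<bar>"] by (simp add: om_def enn2ereal_ennreal)
  have [measurable]: "(\<lambda>u. om (t * u)) \<in> borel_measurable borel"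
    using True mono_modulus_of[of I] unfolding om_def mono_def
    by (intro borel_measurable_mono_ennreal) (auto simp: mono_def mult_left_mono)
  show ?thesis
    unfolding modulus_of_le_iff
  proof (intro ballI impI)
    fix x y assume xy: "x \<in> I" "y \<in> I" "\<bar>x - y\<bar> \<le> t"
    show "maximal_function I f x \<le> maximal_function I f y + ?W"
      unfolding maximal_function_def[of I f x]
    proof (rule SUP_least, clarify)
      fix J assume J: "nondegenerate_interval J" "bounded J" "x \<in> J" "J \<subseteq> I"
      let ?avg = "\<lambda>J. (\<integral>\<^sup>+ y \<in> J. ennreal \<bar>f y\<bar> \<partial>lebesgue) / emeasure lborel J"
      show "?avg J \<le> maximal_function I f y + ?W"
      \<comment> \<open>If \<open>J\<close> contains \<open>y\<close>, it already competes in the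
        supremum at \<open>y\<close>; only the other case needs stretching.\<close>
      proof (cases "y \<in> J")
        case True
        then have "?avg J \<le> maximal_function I f y"
          using J by (intro maximal_function_ge) auto
        then show ?thesis by (simp add: add_increasing2)
      next
        case False
        obtain J' e c d where J': "spans J e c" "spans J' e d" "nondegenerate_interval J'" "bounded J'"
          "y \<in> J'" "J' \<subseteq> I" and cd: "\<bar>c - d\<bar> \<le> \<bar>x - y\<bar>"
          using spans_extend[OF J I xy(2) False] .
        \<comment> \<open>Pulling back to the unit interval along the nondegenerate affine map
          preserves Lebesgue measurability; this is what lets the integral of the sum below be
          split.\<close>
        have meas: "(\<lambda>u. ennreal \<bar>f (e + d * u)\<bar> * indicator {0<..<1} u) \<in> borel_measurable lebesgue"
        proof -
          have d: "d \<noteq> 0" using J'(2) by (rule spans_nonzero)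
          have "(\<lambda>u. e + d * u) \<in> lebesgue \<rightarrow>\<^sub>M lebesgue"
            using lebesgue_affine_measurable[of "\<lambda>_. d" e] d by (simp add: Basis_real_def)
          from measurable_compose[OF this locally_integrable_measurable_spans[OF f J'(2,6)]]
          show ?thesis using d by (simp add: image_affine_iff indicator_def)
        qed
        have "?avg J = (\<integral>\<^sup>+ u \<in> {0<..<1}. ennreal \<bar>f (e + c * u)\<bar> \<partial>lebesgue)"
          using average_spans[OF J'(1) locally_integrable_measurable_spans[OF f J'(1) J(4)]] .
        also have "\<dots> \<le> (\<integral>\<^sup>+ u. ennreal \<bar>f (e + d * u)\<bar> * indicator {0<..<1} u
            + om (t * u) * indicator {0..1} u \<partial>lebesgue)"
        proof (rule nn_integral_mono)
          fix u :: real
          have "ennreal \<bar>f (e + c * u)\<bar> \<le> ennreal \<bar>f (e + d * u)\<bar> + om (t * u)" if "0 < u" "u < 1"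
          proof (rule om)
            show "e + c * u \<in> I" "e + d * u \<in> I"
              using spans_interior[OF J'(1) that] spans_interior[OF J'(2) that] J J' by auto
            have "\<bar>c - d\<bar> * u \<le> t * u" using cd xy that by (intro mult_right_mono) auto
            then show "\<bar>e + c * u - (e + d * u)\<bar> \<le> t * u"
              using that by (simp add: abs_mult left_diff_distrib[symmetric])
          qed
          then show "ennreal \<bar>f (e + c * u)\<bar> * indicator {0<..<1} u
            \<le> ennreal \<bar>f (e + d * u)\<bar> * indicator {0<..<1} u + om (t * u) * indicator {0..1} u"
            by (auto simp: indicator_def)
        qed
        also have "\<dots> = (\<integral>\<^sup>+ u \<in> {0<..<1}. ennreal \<bar>f (e + d * u)\<bar> \<partial>lebesgue)
            + (\<integral>\<^sup>+ u \<in> {0..1}. om (t * u) \<partial>lebesgue)"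
          by (rule nn_integral_add[OF meas]) (auto intro!: measurable_completion)
        also have "(\<integral>\<^sup>+ u \<in> {0..1}. om (t * u) \<partial>lebesgue) = ?W"
          by (simp add: nn_integral_completion om_def)
        also have "(\<integral>\<^sup>+ u \<in> {0<..<1}. ennreal \<bar>f (e + d * u)\<bar> \<partial>lebesgue) = ?avg J'"
          using average_spans[OF J'(2) locally_integrable_measurable_spans[OF f J'(2,6)]] by simp
        also have "?avg J' \<le> maximal_function I f y"
          by (rule maximal_function_ge) (use J' in auto)
        finally show ?thesis by (simp add: add_right_mono)
      qed
    qed
  qed
\<comment> \<open>For negative \<open>t\<close> no pair of points is admissible, so the left-hand
  side is 0.\<close>
qed (auto simp: modulus_of_le_iff)

section \<open>The extremal function at a finite endpoint\<close>

text \<open>A point missing from \<open>I\<close> has all of \<open>I\<close> on one side, so the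
  infimum or the supremum is finite and serves as \<open>e\<close>; \<open>s\<close> is the inward
  direction.\<close>

lemma proper_subinterval_endpoint:
  assumes "proper_subinterval I"
  obtains e s :: real where "\<bar>s\<bar> = 1" "\<forall>x\<in>I. 0 \<le> s * (x - e)"
    "\<forall>r>0. ennreal r < emeasure lborel I \<longrightarrow> e + s * r \<in> I"
proof -
  from assms obtain z p where I: "is_interval I" "p \<in> I" and z: "z \<notin> I"
    unfolding proper_subinterval_def nondegenerate_interval_def by auto
  have between: "x \<in> I" if "a \<in> I" "b \<in> I" "a \<le> x" "x \<le> b" for a b x
    using that I(1) unfolding is_interval_1 by blast
  \<comment> \<open>Used contrapositively: if \<open>r\<close> is below the length of
    \<open>I\<close>, then \<open>I\<close> does not fit into an interval of length
    \<open>r\<close>, so it has points beyond distance \<open>r\<close> from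
    \<open>e\<close>.\<close>
  have small: "emeasure lborel I \<le> ennreal r" if "I \<subseteq> {a..a + r}" "0 < r" for a r
    using emeasure_mono[OF that(1), of lborel] that(2) by simp
  show thesis
  proof (cases "z < p")
    case True
    then have lb: "z \<le> x" if "x \<in> I" for x using between[of x p z] that I z by force
    have bdd: "bdd_below I" by (rule bdd_belowI[OF lb])
    show thesis
    proof (intro that[of 1 "Inf I"] ballI allI impI)
      show "0 \<le> 1 * (x - Inf I)" if "x \<in> I" for x using cInf_lower[OF that bdd] by simp
      fix r :: real assume r: "0 < r" "ennreal r < emeasure lborel I"
      have "\<not> I \<subseteq> {Inf I..Inf I + r}" using small[of "Inf I" r] r by auto
      then obtain b where b: "b \<in> I" "Inf I + r < b" using cInf_lower[OF _ bdd] by fastforce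
      obtain a where "a \<in> I" "a < Inf I + r"
        using r I bdd cInf_less_iff[of I "Inf I + r"] by auto
      with b between[of a b "Inf I + r"] show "Inf I + 1 * r \<in> I" by simp
    qed simp
  next
    case False
    then have ub: "x \<le> z" if "x \<in> I" for x using between[of p x z] that I z by force
    have bdd: "bdd_above I" by (rule bdd_aboveI[OF ub])
    show thesis
    proof (intro that[of "-1" "Sup I"] ballI allI impI)
      show "0 \<le> -1 * (x - Sup I)" if "x \<in> I" for x using cSup_upper[OF that bdd] by simp
      fix r :: real assume r: "0 < r" "ennreal r < emeasure lborel I"
      have "\<not> I \<subseteq> {Sup I - r..Sup I - r + r}" using small[of "Sup I - r" r] r by auto
      then obtain b where b: "b \<in> I" "b < Sup I - r" using cSup_upper[OF _ bdd] by fastforce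
      obtain a where "a \<in> I" "Sup I - r < a"
        using r I bdd less_cSup_iff[of I "Sup I - r"] by auto
      with b between[of b a "Sup I - r"] show "Sup I + -1 * r \<in> I" by simp
    qed simp
  qed
qed

text \<open>The sign \<open>s\<close> treats left and right endpoints at once. \<open>reach\<close>
  is limited to positive \<open>r\<close> since \<open>e\<close> may lie outside \<open>I\<close>;
  values at \<open>e\<close> are therefore replaced by limits along points of
  \<open>I\<close>.\<close>

locale extremal_function =
  fixes I :: "real set" and e s :: real and w :: "real \<Rightarrow> real" and B :: real
  assumes interval: "is_interval I"
    and dir: "\<bar>s\<bar> = 1"
    and side: "\<And>x. x \<in> I \<Longrightarrow> 0 \<le> s * (x - e)"
    and reach: "\<And>r. 0 < r \<Longrightarrow> ennreal r < emeasure lborel I \<Longrightarrow> e + s * r \<in> I"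
    and w: "modulus_of_continuity w"
    and w_le: "\<And>r. 0 \<le> r \<Longrightarrow> w r \<le> B"
begin

definition psi :: "real \<Rightarrow> real" where "psi x = B - w \<bar>x - e\<bar>"

lemma w_nonneg: "0 \<le> r \<Longrightarrow> 0 \<le> w r"
  and w_mono: "0 \<le> q \<Longrightarrow> q \<le> r \<Longrightarrow> w q \<le> w r"
  and w_subadd: "0 \<le> q \<Longrightarrow> 0 \<le> r \<Longrightarrow> w (q + r) \<le> w q + w r"
  and w_continuous: "continuous_on {0..} w"
  and w_0: "w 0 = 0"
  using w unfolding modulus_of_continuity_def mono_on_def by auto

lemma psi_nonneg: "0 \<le> psi x"
  using w_le[of "\<bar>x - e\<bar>"] by (simp add: psi_def)

lemma abs_dir: "\<bar>s * r\<bar> = \<bar>r\<bar>"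
  using dir by (simp add: abs_mult)

lemma psi_dir: "0 \<le> r \<Longrightarrow> psi (e + s * r) = B - w r"
  by (simp add: psi_def abs_dir)

text \<open>The triangle inequality for distances to \<open>e\<close>, carried through
  \<open>w\<close> by monotonicity and subadditivity.\<close>

lemma psi_le: "psi x \<le> psi y + w \<bar>x - y\<bar>"
proof -
  have "w \<bar>y - e\<bar> \<le> w (\<bar>x - e\<bar> + \<bar>x - y\<bar>)" by (intro w_mono) auto
  also have "\<dots> \<le> w \<bar>x - e\<bar> + w \<bar>x - y\<bar>" by (intro w_subadd) auto
  finally show ?thesis by (simp add: psi_def)
qed

lemma w_small:
  assumes "0 < \<eta>"
  obtains d where "0 < d" "\<And>r. 0 \<le> r \<Longrightarrow> r < d \<Longrightarrow> w r < \<eta>"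
proof -
  obtain d where d: "0 < d" "\<And>r. r \<in> {0..} \<Longrightarrow> dist r 0 < d \<Longrightarrow> dist (w r) (w 0) < \<eta>"
    using w_continuous assms unfolding continuous_on_iff by (metis atLeast_iff order_refl)
  show thesis
  proof (rule that[OF d(1)])
    show "w r < \<eta>" if "0 \<le> r" "r < d" for r
      using d(2)[of r] that w_0 by (simp add: dist_real_def)
  qed
qed

lemma psi_uniformly_continuous: "uniformly_continuous_on A psi"
  unfolding uniformly_continuous_on_def
proof (intro allI impI)
  fix \<eta> :: real assume "0 < \<eta>"
  then obtain d where d: "0 < d" "\<And>r. 0 \<le> r \<Longrightarrow> r < d \<Longrightarrow> w r < \<eta>" using w_small by blast
  have "dist (psi x) (psi y) < \<eta>" if "dist x y < d" for x y
    using psi_le[of x y] psi_le[of y x] d(2)[of "\<bar>x - y\<bar>"] that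
    by (auto simp: dist_real_def abs_minus_commute)
  with d show "\<exists>d>0. \<forall>x\<in>A. \<forall>x'\<in>A. dist x' x < d \<longrightarrow> dist (psi x') (psi x) < \<eta>" by blast
qed

lemma psi_measurable [measurable]: "psi \<in> borel_measurable borel"
  by (intro borel_measurable_continuous_onI uniformly_continuous_imp_continuous psi_uniformly_continuous)

lemma psi_locally_integrable: "locally_integrable_on A psi"
  unfolding locally_integrable_on_def set_integrable_def
proof (intro allI impI)
  fix K assume "compact K \<and> K \<subseteq> A"
  then have "integrable lborel (\<lambda>x. indicator K x *\<^sub>R psi x)"
    by (intro borel_integrable_compact uniformly_continuous_imp_continuous psi_uniformly_continuous) auto
  then show "integrable lebesgue (\<lambda>x. indicator K x *\<^sub>R psi x)"
    by (subst integrable_completion) (auto dest: borel_measurable_integrable)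
qed

text \<open>The passage to the limit at \<open>e\<close>: the error \<open>w r\<close> vanishes as
  \<open>r\<close> decreases to 0.\<close>

lemma le_if_le_add_w:
  fixes a b :: ennreal
  assumes "0 < d" "\<And>r. 0 < r \<Longrightarrow> r < d \<Longrightarrow> a \<le> b + ennreal (w r)"
  shows "a \<le> b"
proof (rule ennreal_le_epsilon)
  fix \<eta> :: real assume "0 < \<eta>"
  then obtain d' where d': "0 < d'" "\<And>r. 0 \<le> r \<Longrightarrow> r < d' \<Longrightarrow> w r < \<eta>" using w_small by blast
  define r where "r = min d d' / 2"
  have r: "0 < r" "r < d" "r < d'" using assms(1) d'(1) by (auto simp: r_def)
  have "a \<le> b + ennreal (w r)" using assms(2) r by simp
  also have "\<dots> \<le> b + ennreal \<eta>" using d'(2)[of r] r by (intro add_left_mono ennreal_leI) auto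
  finally show "a \<le> b + ennreal \<eta>" .
qed

text \<open>Strictness of \<open>t < \<bar>I\<bar>\<close> leaves space to shift the pair of points
  at distances 0 and \<open>t\<close> from \<open>e\<close> slightly inward.\<close>

lemma room:
  assumes "0 < t" "ennreal t < emeasure lborel I"
  obtains d where "0 < d" "\<And>r. 0 < r \<Longrightarrow> r < d \<Longrightarrow> e + s * r \<in> I \<and> e + s * (t + r) \<in> I
    \<and> ennreal r < emeasure lborel I"
proof -
  \<comment> \<open>The intermediate value is chosen among extended reals because the length of
    \<open>I\<close> may be infinite; being below that length makes it finite.\<close>
  obtain q where q: "ennreal t < q" "q < emeasure lborel I" using dense[OF assms(2)] by auto
  obtain u where u: "q = ennreal u" "0 \<le> u"
    using q(2) by (cases q rule: ennreal_cases) auto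
  have tu: "t < u" using q u assms by (simp add: ennreal_less_iff)
  have *: "ennreal v < emeasure lborel I" if "v \<le> u" for v
    using q(2) that unfolding u(1) by (meson ennreal_leI order.strict_trans1)
  show thesis
  proof (rule that[of "min t (u - t)"])
    fix r assume r: "0 < r" "r < min t (u - t)"
    then show "e + s * r \<in> I \<and> e + s * (t + r) \<in> I \<and> ennreal r < emeasure lborel I"
      using reach[of r] reach[of "t + r"] *[of r] *[of "t + r"] tu assms by auto
  qed (use tu assms in auto)
qed

lemma modulus_of_psi_le:
  assumes "0 \<le> t"
  shows "modulus_of I (\<lambda>x. ereal (psi x)) t \<le> ennreal (w t)"
proof -
  have "(\<lambda>x. ereal (psi x)) = (\<lambda>x. enn2ereal (ennreal (psi x)))"
    using psi_nonneg by (simp add: enn2ereal_ennreal)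
  moreover have "ennreal (psi x) \<le> ennreal (psi y) + ennreal (w t)" if "\<bar>x - y\<bar> \<le> t" for x y
  proof -
    have "psi x \<le> psi y + w t" using psi_le[of x y] w_mono[of "\<bar>x - y\<bar>" t] that by simp
    then show ?thesis
      using psi_nonneg w_nonneg[OF assms] by (simp add: ennreal_leI flip: ennreal_plus)
  qed
  ultimately show ?thesis by (simp add: modulus_of_le_iff)
qed

text \<open>For the lower bound, the values at distances \<open>r\<close> and \<open>t + r\<close>
  from \<open>e\<close> differ by \<open>w (t + r) - w r\<close>, which is at least
  \<open>w t - w r\<close>; then \<open>r\<close> tends to 0.\<close>

lemma modulus_of_psi:
  assumes t: "0 < t" "ennreal t < emeasure lborel I"
  shows "modulus_of I (\<lambda>x. ereal (psi x)) t = ennreal (w t)"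
proof (rule antisym)
  show "modulus_of I (\<lambda>x. ereal (psi x)) t \<le> ennreal (w t)" using modulus_of_psi_le t by simp
  obtain d where d: "0 < d" "\<And>r. 0 < r \<Longrightarrow> r < d \<Longrightarrow> e + s * r \<in> I \<and> e + s * (t + r) \<in> I
    \<and> ennreal r < emeasure lborel I" using room[OF t] by blast
  show "ennreal (w t) \<le> modulus_of I (\<lambda>x. ereal (psi x)) t" (is "_ \<le> ?m")
  proof (rule le_if_le_add_w[OF d(1)])
    fix r assume r: "0 < r" "r < d"
    let ?x = "e + s * r" and ?y = "e + s * (t + r)"
    have eq: "(\<lambda>x. ereal (psi x)) = (\<lambda>x. enn2ereal (ennreal (psi x)))"
      using psi_nonneg by (simp add: enn2ereal_ennreal)
    have "\<bar>?x - ?y\<bar> = \<bar>s * t\<bar>" by (simp add: algebra_simps)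
    then have "\<bar>?x - ?y\<bar> \<le> t" using t by (simp add: abs_dir)
    then have "ennreal (psi ?x) \<le> ennreal (psi ?y) + ?m"
      unfolding eq using d(2)[OF r] by (intro le_add_modulus_of) auto
    then have x: "ennreal (psi ?x) + ennreal (w r) \<le> ennreal (psi ?y) + ?m + ennreal (w r)"
      by (rule add_right_mono)
    have "psi ?y + w t \<le> psi ?x + w r"
      using psi_dir[of r] psi_dir[of "t + r"] w_mono[of t "t + r"] t r by simp
    then have "ennreal (psi ?y) + ennreal (w t) \<le> ennreal (psi ?x) + ennreal (w r)"
      using psi_nonneg w_nonneg t r by (simp add: ennreal_leI flip: ennreal_plus)
    also note x
    finally have "ennreal (psi ?y) + ennreal (w t) \<le> ennreal (psi ?y) + (?m + ennreal (w r))"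
      by (simp only: add.assoc)
    then show "ennreal (w t) \<le> ?m + ennreal (w r)"
      by (simp add: ennreal_add_left_cancel_le)
  qed
qed

section \<open>The maximal function of the extremal function\<close>

text \<open>\<open>B - W r\<close> is the average of \<open>psi\<close> over the interval from
  \<open>e\<close> to \<open>e + s * r\<close>.\<close>

definition W :: "real \<Rightarrow> ennreal" where
  "W r = (\<integral>\<^sup>+ u \<in> {0..1}. ennreal (w (r * u)) \<partial>lborel)"

lemma W_mono: "0 \<le> q \<Longrightarrow> q \<le> r \<Longrightarrow> W q \<le> W r"
  unfolding W_def
  by (intro nn_integral_mono) (auto simp: indicator_def intro!: ennreal_leI w_mono mult_right_mono)

lemma W_measurable:
  assumes "0 \<le> r"
  shows "(\<lambda>u. ennreal (w (r * u)) * indicator {0..1} u) \<in> borel_measurable borel"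
proof -
  have "continuous_on {0..1} (\<lambda>u. w (r * u))"
    using assms by (intro continuous_on_compose2[OF w_continuous] continuous_intros) auto
  then have "(\<lambda>u. indicator {0..1} u *\<^sub>R w (r * u)) \<in> borel_measurable borel"
    by (intro borel_measurable_continuous_on_indicator) auto
  then have "(\<lambda>u. ennreal (indicator {0..1} u *\<^sub>R w (r * u))) \<in> borel_measurable borel"
    by measurable
  also have "(\<lambda>u. ennreal (indicator {0..1} u *\<^sub>R w (r * u)))
      = (\<lambda>u. ennreal (w (r * u)) * indicator {0..1} u)"
    by (auto simp: indicator_def)
  finally show ?thesis .
qed

lemma psi_average:
  assumes "spans J a c"
  shows "(\<integral>\<^sup>+ y \<in> J. ennreal \<bar>psi y\<bar> \<partial>lebesgue) / emeasure lborel J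
    = (\<integral>\<^sup>+ u \<in> {0<..<1}. ennreal (psi (a + c * u)) \<partial>lborel)"
  using average_spans[OF assms locally_integrable_measurable_spans[OF psi_locally_integrable assms subset_UNIV]]
  by (simp add: psi_nonneg nn_integral_completion)

text \<open>Measured from \<open>e\<close>, an admissible \<open>J\<close> runs from
  \<open>p \<ge> 0\<close> to \<open>p + L\<close>, and \<open>y\<close> lies at distance
  \<open>d \<le> p + L\<close>. At relative position \<open>u\<close> its point has distance
  \<open>p + L * u \<ge> d * u\<close>, so \<open>psi\<close> there is at most
  \<open>B - w (d * u)\<close>. The additive form avoids truncated subtraction.\<close>

lemma maximal_psi_upper:
  assumes y: "y \<in> I"
  shows "maximal_function I psi y + W (s * (y - e)) \<le> ennreal B"
proof -
  define d where "d = s * (y - e)"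
  have d: "0 \<le> d" using side[OF y] by (simp add: d_def)
  have ss: "s * s = 1" using dir by (metis abs_mult_self_eq mult_1)
  have each: "(\<integral>\<^sup>+ x \<in> J. ennreal \<bar>psi x\<bar> \<partial>lebesgue) / emeasure lborel J + W d \<le> ennreal B"
    if J: "nondegenerate_interval J" "bounded J" "y \<in> J" "J \<subseteq> I" for J
  proof -
    obtain a L where L: "0 < L" "spans J a (s * L)" using spans_exists_dir[OF J(1,2) dir] .
    define p where "p = s * (a - e)"
    have coord: "s * (a + s * L * u - e) = p + L * u" for u
    proof -
      have "s * (a + s * L * u - e) = p + s * s * L * u" by (simp add: p_def algebra_simps)
      then show ?thesis by (simp add: ss)
    qed
    \<comment> \<open>The endpoint \<open>a\<close> need not belong to \<open>I\<close>, so its sign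
      is read off from interior points of \<open>J\<close> with small parameter.\<close>
    have p: "0 \<le> p"
    proof (rule field_le_epsilon)
      fix \<eta> :: real assume \<eta>: "0 < \<eta>"
      define u where "u = min (1/2) (\<eta> / L)"
      have u: "0 < u" "u < 1" "L * u \<le> \<eta>" using \<eta> L(1) by (auto simp: u_def min_def field_simps)
      have "0 \<le> p + L * u"
        using side[of "a + s * L * u"] spans_interior[OF L(2) u(1,2)] J(4) coord by auto
      then show "0 \<le> p + \<eta>" using u by simp
    qed
    obtain v where v: "0 \<le> v" "v \<le> 1" "y = a + s * L * v" using spansE[OF L(2) J(3)] .
    have "d = p + L * v" using coord[of v] v by (simp add: d_def)
    then have dp: "d \<le> p + L" using mult_left_le[OF v(2) less_imp_le[OF L(1)]] by linarith
    have pt: "psi (a + s * L * u) + w (d * u) \<le> B" if "0 < u" "u < 1" for u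
    proof -
      have "d * u \<le> (p + L) * u" using dp that by (intro mult_right_mono) auto
      also have "\<dots> \<le> p + L * u" using mult_left_le[of u p] that p by (simp add: algebra_simps)
      also have "\<dots> \<le> \<bar>s * (a + s * L * u - e)\<bar>" unfolding coord by simp
      finally have "d * u \<le> \<bar>a + s * L * u - e\<bar>" by (simp add: abs_dir)
      then have "w (d * u) \<le> w \<bar>a + s * L * u - e\<bar>" using d that by (intro w_mono) auto
      then show ?thesis by (simp add: psi_def)
    qed
    have "(\<integral>\<^sup>+ x \<in> J. ennreal \<bar>psi x\<bar> \<partial>lebesgue) / emeasure lborel J + W d
      = (\<integral>\<^sup>+ u. ennreal (psi (a + s * L * u)) * indicator {0<..<1} u
          + ennreal (w (d * u)) * indicator {0..1} u \<partial>lborel)"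
      unfolding psi_average[OF L(2)] W_def
      by (subst nn_integral_add) (use W_measurable[OF d] in auto)
    also have "\<dots> \<le> (\<integral>\<^sup>+ u. ennreal B * indicator {0..1::real} u \<partial>lborel)"
    proof (rule nn_integral_mono_AE)
      \<comment> \<open>At the parameters 0 and 1 only the second summand is supported; these two
        points are discarded as null.\<close>
      have "AE u in lborel. u \<noteq> (0::real)" "AE u in lborel. u \<noteq> (1::real)"
        by (rule AE_lborel_singleton)+
      then show "AE u in lborel. ennreal (psi (a + s * L * u)) * indicator {0<..<1} u
          + ennreal (w (d * u)) * indicator {0..1} u \<le> ennreal B * indicator {0..1} u"
      proof eventually_elim
        case (elim u)
        show ?case
        proof (cases "0 < u \<and> u < 1")
          case True
          then show ?thesis
            using pt[of u] psi_nonneg[of "a + s * L * u"] w_nonneg[of "d * u"] d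
            by (simp add: ennreal_leI flip: ennreal_plus)
        next
          case False
          with elim have "u \<notin> {0..1}" by auto
          then show ?thesis by (auto simp: indicator_def)
        qed
      qed
    qed
    also have "\<dots> = ennreal B" by (simp add: nn_integral_cmult)
    finally show ?thesis .
  qed
  let ?A = "{J. nondegenerate_interval J \<and> bounded J \<and> y \<in> J \<and> J \<subseteq> I}"
  \<comment> \<open>This allows the subtraction in \<open>ennreal B - W d\<close> to be undone at
    the end.\<close>
  have "W d \<le> ennreal B"
  proof -
    have "W d \<le> (\<integral>\<^sup>+ u. ennreal B * indicator {0..1::real} u \<partial>lborel)"
      unfolding W_def using d
      by (intro nn_integral_mono) (auto simp: indicator_def intro!: ennreal_leI w_le)
    then show ?thesis by (simp add: nn_integral_cmult)
  qed
  moreover have "maximal_function I psi y \<le> ennreal B - W d"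
    unfolding maximal_function_def
    by (rule SUP_least) (use each in \<open>auto simp: ennreal_le_minus_iff\<close>)
  ultimately show ?thesis
    unfolding d_def[symmetric] by (metis add_right_mono diff_add_cancel_ennreal)
qed

text \<open>All points of the test interval are within distance \<open>r\<close> of
  \<open>e\<close>, so \<open>psi\<close> is at least \<open>B - w r\<close> on it. This crude bound
  suffices because it is applied as \<open>r\<close> tends to 0.\<close>

lemma maximal_psi_lower:
  assumes r: "0 < r" "ennreal r < emeasure lborel I"
  shows "ennreal B \<le> maximal_function I psi (e + s * r) + ennreal (w r)"
proof -
  \<comment> \<open>The interval goes from \<open>x\<close> only halfway towards \<open>e\<close>,
    so it stays in \<open>I\<close> even when \<open>e\<close> is not in \<open>I\<close>.\<close>
  define x c where "x = e + s * r" and "c = - (s * r / 2)"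
  define J where "J = (\<lambda>u. x + c * u) ` {0..1}"
  have c: "c \<noteq> 0" using r dir by (auto simp: c_def)
  have coord: "x + c * u = e + s * (r * (1 - u / 2))" for u
    by (simp add: x_def c_def algebra_simps)
  have sp: "spans J x c" using c by (auto simp: spans_def J_def)
  have xJ: "x \<in> J" "x + c \<in> J" unfolding J_def by (force intro: image_eqI[of _ _ 0] image_eqI[of _ _ 1])+
  have "is_interval J"
    unfolding J_def is_interval_connected_1
    by (intro connected_continuous_image continuous_intros) auto
  moreover have "\<exists>a\<in>J. \<exists>b\<in>J. a < b"
  proof (cases "0 < c")
    case True
    then have "x < x + c" by simp
    then show ?thesis using xJ by blast
  next
    case False
    then have "x + c < x" using c by simp
    then show ?thesis using xJ by blast
  qed
  ultimately have nd: "nondegenerate_interval J" by (simp add: nondegenerate_interval_def)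
  have bd: "bounded J"
    unfolding J_def by (intro compact_imp_bounded compact_continuous_image continuous_intros) auto
  have JI: "J \<subseteq> I"
  proof
    fix z assume "z \<in> J"
    then obtain u where u: "0 \<le> u" "u \<le> 1" "z = e + s * (r * (1 - u / 2))"
      unfolding J_def coord by auto
    have "r * (1 - u / 2) \<le> r" using r u by (simp add: mult_left_le)
    then have "ennreal (r * (1 - u / 2)) < emeasure lborel I"
      using r(2) ennreal_leI order.strict_trans1 by blast
    then show "z \<in> I" unfolding u(3) using u r by (intro reach) auto
  qed
  have "ennreal B = ennreal (B - w r) + ennreal (w r)"
    using w_le[of r] w_nonneg[of r] r by (simp flip: ennreal_plus)
  also have "ennreal (B - w r) = (\<integral>\<^sup>+ u. ennreal (B - w r) * indicator {0<..<1::real} u \<partial>lborel)"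
    by (simp add: nn_integral_cmult)
  also have "\<dots> \<le> (\<integral>\<^sup>+ u \<in> {0<..<1}. ennreal (psi (x + c * u)) \<partial>lborel)"
  proof (rule nn_integral_mono)
    fix u :: real
    have "B - w r \<le> psi (x + c * u)" if "0 < u" "u < 1"
      unfolding coord using that r by (subst psi_dir) (auto intro!: w_mono simp: mult_left_le)
    then show "ennreal (B - w r) * indicator {0<..<1} u \<le> ennreal (psi (x + c * u)) * indicator {0<..<1} u"
      by (auto simp: indicator_def intro: ennreal_leI)
  qed
  also have "\<dots> \<le> maximal_function I psi x"
    unfolding psi_average[OF sp, symmetric] using nd bd xJ(1) JI by (rule maximal_function_ge)
  finally show ?thesis by (simp add: x_def add_right_mono)
qed

text \<open>The upper bound is the general inequality. For the lower one, the maximal function is at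
  least \<open>B - w r\<close> at distance \<open>r\<close> from \<open>e\<close> and at most
  \<open>B - W (t + r)\<close> at distance \<open>t + r\<close>; the gap is at least
  \<open>W t - w r\<close>.\<close>

lemma modulus_of_maximal_psi:
  assumes t: "0 < t" "ennreal t < emeasure lborel I"
  shows "modulus_of I (\<lambda>x. enn2ereal (maximal_function I psi x)) t = W t"
proof (rule antisym)
  let ?m = "modulus_of I (\<lambda>x. enn2ereal (maximal_function I psi x)) t"
  have "?m \<le> (\<integral>\<^sup>+ u \<in> {0..1}. modulus_of I (\<lambda>x. ereal \<bar>psi x\<bar>) (t * u) \<partial>lborel)"
    by (rule modulus_of_maximal_function_le[OF interval psi_locally_integrable])
  also have "\<dots> \<le> W t"
    unfolding W_def using t
    by (intro nn_integral_mono) (auto simp: indicator_def psi_nonneg intro!: modulus_of_psi_le)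
  finally show "?m \<le> W t" .
  obtain d where d: "0 < d" "\<And>r. 0 < r \<Longrightarrow> r < d \<Longrightarrow> e + s * r \<in> I \<and> e + s * (t + r) \<in> I
    \<and> ennreal r < emeasure lborel I" using room[OF t] by blast
  show "W t \<le> ?m"
  proof (rule le_if_le_add_w[OF d(1)])
    fix r assume r: "0 < r" "r < d"
    let ?x = "e + s * r" and ?y = "e + s * (t + r)"
    have ss: "s * s = 1" using dir by (metis abs_mult_self_eq mult_1)
    have "s * (?y - e) = (s * s) * (t + r)" by (simp add: algebra_simps)
    also have "\<dots> = t + r" by (simp only: ss mult_1)
    finally have up: "maximal_function I psi ?y + W (t + r) \<le> ennreal B"
      using maximal_psi_upper[of ?y] d(2)[OF r] by metis
    have "\<bar>?x - ?y\<bar> = \<bar>s * t\<bar>" by (simp add: algebra_simps)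
    then have "\<bar>?x - ?y\<bar> \<le> t" using t by (simp add: abs_dir)
    then have mod: "maximal_function I psi ?x \<le> maximal_function I psi ?y + ?m"
      using d(2)[OF r] by (intro le_add_modulus_of) auto
    have "maximal_function I psi ?y + W t \<le> maximal_function I psi ?y + W (t + r)"
      using t r by (intro add_left_mono W_mono) auto
    also note up
    also have "ennreal B \<le> maximal_function I psi ?x + ennreal (w r)"
      using d(2)[OF r] r by (intro maximal_psi_lower) auto
    also have "\<dots> \<le> maximal_function I psi ?y + ?m + ennreal (w r)"
      by (intro add_right_mono mod)
    finally have "maximal_function I psi ?y + W t \<le> maximal_function I psi ?y + (?m + ennreal (w r))"
      by (simp add: add.assoc)
    \<comment> \<open>Finiteness is what permits cancelling this term from both sides.\<close>
    moreover have "maximal_function I psi ?y \<noteq> top"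
      using up by (metis add_top_left_ennreal ennreal_neq_top top_unique)
    ultimately show "W t \<le> ?m + ennreal (w r)"
      by (simp add: ennreal_add_left_cancel_le)
  qed
qed

end

section \<open>Sharpness for bounded moduli, and truncation of unbounded ones\<close>

proposition bounded_modulus_sharp:
  assumes I: "proper_subinterval I" and w: "modulus_of_continuity w" and bdd: "bounded (w ` {0..})"
  shows "\<exists>\<psi> :: real \<Rightarrow> real. (\<forall>x\<in>I. 0 \<le> \<psi> x) \<and> uniformly_continuous_on I \<psi> \<and>
    (\<forall>t. 0 < t \<and> ennreal t < emeasure lborel I \<longrightarrow>
      modulus_of I (\<lambda>x. ereal (\<psi> x)) t = ennreal (w t) \<and>
      modulus_of I (\<lambda>x. enn2ereal (maximal_function I \<psi> x)) t
        = (\<integral>\<^sup>+ u \<in> {0..1}. ennreal (w (t * u)) \<partial>lborel))"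
proof -
  obtain e s :: real where es: "\<bar>s\<bar> = 1" "\<forall>x\<in>I. 0 \<le> s * (x - e)"
    "\<forall>r>0. ennreal r < emeasure lborel I \<longrightarrow> e + s * r \<in> I"
    using proper_subinterval_endpoint[OF I] .
  obtain B where "\<forall>x \<in> w ` {0..}. norm x \<le> B"
    using bdd unfolding bounded_iff by blast
  then have B: "w r \<le> B" if "0 \<le> r" for r using that by force
  interpret extremal_function I e s w B
    using I es w B by unfold_locales (auto simp: proper_subinterval_def nondegenerate_interval_def)
  show ?thesis
    using psi_nonneg psi_uniformly_continuous modulus_of_psi modulus_of_maximal_psi
    unfolding W_def by (intro exI[of _ psi]) simp
qed

text \<open>Subadditivity survives because
  \<open>min (q + r) \<delta> \<le> min q \<delta> + min r \<delta>\<close>. The truncation is not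
  identically zero: if \<open>w \<delta> = 0\<close>, subadditivity would make \<open>w\<close>
  vanish at all multiples of \<open>\<delta>\<close>, hence everywhere by monotonicity.\<close>

lemma modulus_of_continuity_truncate:
  assumes w: "modulus_of_continuity w" and \<delta>: "0 < \<delta>"
  shows "modulus_of_continuity (\<lambda>r. w (min r \<delta>))" "bounded ((\<lambda>r. w (min r \<delta>)) ` {0..})"
proof -
  have pos: "\<And>r. 0 \<le> r \<Longrightarrow> 0 \<le> w r" and mono: "\<And>q r. 0 \<le> q \<Longrightarrow> q \<le> r \<Longrightarrow> w q \<le> w r"
    and sub: "\<And>q r. 0 \<le> q \<Longrightarrow> 0 \<le> r \<Longrightarrow> w (q + r) \<le> w q + w r"
    and cont: "continuous_on {0..} w" and w0: "w 0 = 0" and nz: "\<exists>r\<ge>0. w r \<noteq> 0"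
    using w unfolding modulus_of_continuity_def mono_on_def by auto
  have "w (min (q + r) \<delta>) \<le> w (min q \<delta>) + w (min r \<delta>)" if "0 \<le> q" "0 \<le> r" for q r
  proof -
    have "w (min (q + r) \<delta>) \<le> w (min q \<delta> + min r \<delta>)" using that \<delta> by (intro mono) auto
    also have "\<dots> \<le> w (min q \<delta>) + w (min r \<delta>)" using that \<delta> by (intro sub) auto
    finally show ?thesis .
  qed
  moreover have "\<exists>r\<ge>0. w (min r \<delta>) \<noteq> 0"
  proof (rule ccontr)
    assume "\<not> ?thesis"
    then have "w \<delta> = 0" using \<delta> by (metis less_imp_le min.idem)
    have n: "w (real n * \<delta>) = 0" for n
    proof (induction n)
      case (Suc n)
      have "w (real (Suc n) * \<delta>) \<le> w (real n * \<delta>) + w \<delta>"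
        using sub[of "real n * \<delta>" \<delta>] \<delta> by (simp add: algebra_simps)
      moreover have "0 \<le> w (real (Suc n) * \<delta>)" using \<delta> by (intro pos) auto
      ultimately show ?case using Suc \<open>w \<delta> = 0\<close> by simp
    qed (simp add: w0)
    obtain r where r: "0 \<le> r" "w r \<noteq> 0" using nz by auto
    obtain n where "r < real n * \<delta>" using reals_Archimedean3[OF \<delta>] by blast
    then show False using mono[of r "real n * \<delta>"] pos[of r] n[of n] r by simp
  qed
  moreover have "continuous_on {0..} (\<lambda>r. w (min r \<delta>))"
    using \<delta> by (intro continuous_on_compose2[OF cont] continuous_intros) auto
  ultimately show "modulus_of_continuity (\<lambda>r. w (min r \<delta>))"
    using pos mono w0 \<delta> unfolding modulus_of_continuity_def mono_on_def by auto
  have "norm (w (min r \<delta>)) \<le> w \<delta>" if "0 \<le> r" for r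
    using pos[of "min r \<delta>"] mono[of "min r \<delta>" \<delta>] that \<delta> by simp
  then show "bounded ((\<lambda>r. w (min r \<delta>)) ` {0..})" unfolding bounded_iff by auto
qed

theorem theorem4p3:
  fixes I :: "real set"
  assumes "proper_subinterval I"
  shows
    "(\<forall>f :: real \<Rightarrow> real. locally_integrable_on I f \<longrightarrow>
        (\<forall>t>0. modulus_of I (\<lambda>x. enn2ereal (maximal_function I f x)) t
                 \<le> (\<integral>\<^sup>+ u \<in> {0..1}. modulus_of I (\<lambda>x. ereal \<bar>f x\<bar>) (t * u) \<partial>lborel)))
     \<and>
     (\<forall>(w :: real \<Rightarrow> real) (\<delta> :: real).
        modulus_of_continuity w \<and> 0 < \<delta> \<and> ennreal \<delta> \<le> emeasure lborel I \<longrightarrow>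
        (\<exists>\<psi> :: real \<Rightarrow> real.
           (\<forall>x\<in>I. 0 \<le> \<psi> x) \<and> uniformly_continuous_on I \<psi> \<and>
           (\<forall>t. 0 < t \<and> t < \<delta> \<longrightarrow>
              modulus_of I (\<lambda>x. ereal (\<psi> x)) t = ennreal (w t) \<and>
              modulus_of I (\<lambda>x. enn2ereal (maximal_function I \<psi> x)) t
                = (\<integral>\<^sup>+ u \<in> {0..1}. ennreal (w (t * u)) \<partial>lborel))))
     \<and>
     (\<forall>w :: real \<Rightarrow> real.
        modulus_of_continuity w \<and> bounded (w ` {0..}) \<longrightarrow>
        (\<exists>\<psi> :: real \<Rightarrow> real.
           (\<forall>x\<in>I. 0 \<le> \<psi> x) \<and> uniformly_continuous_on I \<psi> \<and>
           (\<forall>t. 0 < t \<and> ennreal t < emeasure lborel I \<longrightarrow>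
              modulus_of I (\<lambda>x. ereal (\<psi> x)) t = ennreal (w t) \<and>
              modulus_of I (\<lambda>x. enn2ereal (maximal_function I \<psi> x)) t
                = (\<integral>\<^sup>+ u \<in> {0..1}. ennreal (w (t * u)) \<partial>lborel))))"
proof (intro conjI allI impI)
  have I: "is_interval I"
    using assms by (simp add: proper_subinterval_def nondegenerate_interval_def)
  show "modulus_of I (\<lambda>x. enn2ereal (maximal_function I f x)) t
      \<le> (\<integral>\<^sup>+ u \<in> {0..1}. modulus_of I (\<lambda>x. ereal \<bar>f x\<bar>) (t * u) \<partial>lborel)"
    if "locally_integrable_on I f" for f t
    by (rule modulus_of_maximal_function_le[OF I that])
next
  fix w :: "real \<Rightarrow> real" and \<delta> :: real
  assume "modulus_of_continuity w \<and> 0 < \<delta> \<and> ennreal \<delta> \<le> emeasure lborel I"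
  then have w: "modulus_of_continuity w" and \<delta>: "0 < \<delta>" "ennreal \<delta> \<le> emeasure lborel I" by auto
  obtain \<psi> where \<psi>: "\<forall>x\<in>I. 0 \<le> \<psi> x" "uniformly_continuous_on I \<psi>"
    "\<forall>t. 0 < t \<and> ennreal t < emeasure lborel I \<longrightarrow>
      modulus_of I (\<lambda>x. ereal (\<psi> x)) t = ennreal (w (min t \<delta>)) \<and>
      modulus_of I (\<lambda>x. enn2ereal (maximal_function I \<psi> x)) t
        = (\<integral>\<^sup>+ u \<in> {0..1}. ennreal (w (min (t * u) \<delta>)) \<partial>lborel)"
    using bounded_modulus_sharp[OF assms modulus_of_continuity_truncate[OF w \<delta>(1)]] by (elim exE conjE)
  have "modulus_of I (\<lambda>x. ereal (\<psi> x)) t = ennreal (w t) \<and>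
      modulus_of I (\<lambda>x. enn2ereal (maximal_function I \<psi> x)) t
        = (\<integral>\<^sup>+ u \<in> {0..1}. ennreal (w (t * u)) \<partial>lborel)" if t: "0 < t" "t < \<delta>" for t
  proof -
    have "ennreal t < emeasure lborel I"
      using t \<delta> by (intro order.strict_trans2[OF _ \<delta>(2)]) (simp add: ennreal_less_iff)
    \<comment> \<open>Since \<open>t * u \<le> t < \<delta>\<close> on the unit interval, the
      integral never sees the truncation.\<close>
    moreover have "min (t * u) \<delta> = t * u" if "0 \<le> u" "u \<le> 1" for u
      using mult_left_le[OF that(2) less_imp_le[OF t(1)]] t by linarith
    then have "(\<integral>\<^sup>+ u \<in> {0..1}. ennreal (w (min (t * u) \<delta>)) \<partial>lborel)
        = (\<integral>\<^sup>+ u \<in> {0..1}. ennreal (w (t * u)) \<partial>lborel)"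
      by (intro nn_integral_cong) (auto simp: indicator_def)
    ultimately show ?thesis using \<psi>(3) t by simp
  qed
  with \<psi>(1,2) show "\<exists>\<psi>. (\<forall>x\<in>I. 0 \<le> \<psi> x) \<and> uniformly_continuous_on I \<psi> \<and>
      (\<forall>t. 0 < t \<and> t < \<delta> \<longrightarrow> modulus_of I (\<lambda>x. ereal (\<psi> x)) t = ennreal (w t) \<and>
        modulus_of I (\<lambda>x. enn2ereal (maximal_function I \<psi> x)) t
          = (\<integral>\<^sup>+ u \<in> {0..1}. ennreal (w (t * u)) \<partial>lborel))"
    by blast
next
  fix w :: "real \<Rightarrow> real"
  assume "modulus_of_continuity w \<and> bounded (w ` {0..})"
  then show "\<exists>\<psi>. (\<forall>x\<in>I. 0 \<le> \<psi> x) \<and> uniformly_continuous_on I \<psi> \<and>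
      (\<forall>t. 0 < t \<and> ennreal t < emeasure lborel I \<longrightarrow>
        modulus_of I (\<lambda>x. ereal (\<psi> x)) t = ennreal (w t) \<and>
        modulus_of I (\<lambda>x. enn2ereal (maximal_function I \<psi> x)) t
          = (\<integral>\<^sup>+ u \<in> {0..1}. ennreal (w (t * u)) \<partial>lborel))"
    by (intro bounded_modulus_sharp[OF assms]) auto
qed

end
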